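(* Let $n\in\mathbb N$ and let $\pi=\pi_{\mathrm g=n}$ be the projection according to the word length grading. Then for any family of vectors $\mathbf V$, any words $u,v\in\mathbb A^*$ and any linear endomorphisms $X,Y$ of $\mathbb R\langle\mathbb A\rangle_*$: (i) $E\circ|S|=E$; (ii) $|S|(u*v)=\bigl(|S|(u)\bigr)*\bigl(|S|(v)\bigr)$; (iii) $\langle|S|\circ X,Y\rangle=\langle X,|S|\circ Y\rangle$; (iv) $\langle X,Y\rangle=\langle|S|\circ X,|S|\circ Y\rangle$; (v) $\|\pi\circ S\|^2=\|\pi\circ\mathrm{id}\|^2$; (vi) $\bigl\langle\pi\circ\tfrac12(\mathrm{id}-S)\,,\,\pi\circ\tfrac12(\mathrm{id}+S)\bigr\rangle=0$.
   Context: Alphabet: let $W^0_t\equiv t$, $W^1,\dots,W^d$ be Wiener processes and $J^i_t=\int_0^t\int_{\mathbb R}v\,\overline Q^i(\mathrm dv,\mathrm ds)$, $d<i\le\ell$, be purely discontinuous martingales, all independent and with moments of all orders, where $\overline Q^i$ is the compensation of a Poisson measure with intensity $\rho^i(\mathrm dv)\mathrm ds$. For $p\ge2$ put $J^{i^{(p)}}_t=\int_0^t\int_{\mathbb R}v^p\,\overline Q^i(\mathrm dv,\mathrm ds)$. The alphabet $\mathbb A$ consists of $0,1,\dots,\ell$ together with the letters $i^{(p)}$ ($p\ge2$, $d<i\le\ell$) for which $J^{i^{(p)}}$ is not in the linear span of $\{t,J^i,\dots,J^{i^{(p-1)}}\}$; $i^{(1)}=i$. $\mathbb A^*$ is the set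 of words over $\mathbb A$ and $\mathbb R\langle\mathbb A\rangle$ the vector space with basis $\mathbb A^*$. Quasi-shuffle algebra $\mathbb R\langle\mathbb A\rangle_*$: the product $*$ satisfies $u*\mathbf 1=\mathbf 1*u=u$ ($\mathbf 1$ the empty word) and $ua*vb=(u*vb)a+(ua*v)b+(u*v)[a,b]$ for words $u,v$, letters $a,b$, where $[\cdot,\cdot]$ is the commutative associative bilinear product on the span of the letters with $[0,a]=0$ for all $a$; $[i,j]=\delta_{ij}\cdot 0$ (multiple of the letter $0$) for $i,j\in\{1,\dots,d\}$; $[i^{(p)},j^{(q)}]=0$ for $i\ne j$; $[i^{(p)},i^{(q)}]=\bigl(\int v^{p+q}\rho^i(\mathrm dv)\bigr)\cdot 0+i^{(p+q)}$ for $i>d$ (where $0$ is the letter $0$, and if $i^{(p+q)}\notin\mathbb A$ it stands for the linear combination of letters representing $J^{i^{(p+q)}}$). Maps: $|S|(a_1\ldots a_m)=a_m\ldots a_1$ and $S(a_1\ldots a_m)=(-1)^ma_m\ldots a_1$, extended linearly. $\pi_{\mathrm g=n}$ is the linear projection fixing words of length $n$ and sending all other words to $0$. The expectation map $E:\mathbb R\langle\mathbb A\rangle\to\mathbb R[t]$ is the linear map with $E(w)=t^{|w|}/|w|!$ if every letter of $w$ is $0$ (including the empty word) and $E(w)=0$ otherwise. Inner product: $\mathbf V$ is given by a family of (indeterminate) vectors $\{\mathbf V_w\}_{w\in\mathbb A^*}$, $(u,v)=\mathbf V_u^{\mathrm T}\mathbf V_v$, and for linear endomorphisms $X,Y$ of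 $\mathbb R\langle\mathbb A\rangle_*$ $$\langle X,Y\rangle=\sum_{u,v\in\mathbb A^*}E\bigl(X(u)*Y(v)\bigr)\,(u,v),\qquad\|X\|^2=\langle X,X\rangle,$$ the sums being understood formally in the symbols $(u,v)$ (or assumed convergent). *)

theory Defs
  imports "HOL-Probability.Probability" "HOL-Analysis.Finite_Function_Topology" "HOL-Library.Uprod"
    "HOL-Computational_Algebra.Polynomial"
begin

section \<open>Driving processes\<close>

definition wiener_process :: "'w measure \<Rightarrow> (real \<Rightarrow> 'w \<Rightarrow> real) \<Rightarrow> bool" where
  "wiener_process M W \<longleftrightarrow>
     (\<forall>t\<ge>0. W t \<in> borel_measurable M) \<and>
     (AE \<omega> in M. W 0 \<omega> = 0) \<and>
     (AE \<omega> in M. continuous_on {0..} (\<lambda>t. W t \<omega>)) \<and>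
     (\<forall>s t. 0 \<le> s \<and> s < t \<longrightarrow>
        distributed M lborel (\<lambda>\<omega>. W t \<omega> - W s \<omega>) (normal_density 0 (sqrt (t - s)))) \<and>
     (\<forall>(n::nat) \<tau>. 0 \<le> \<tau> 0 \<and> (\<forall>k<n. \<tau> k \<le> \<tau> (Suc k)) \<longrightarrow>
        prob_space.indep_vars M (\<lambda>_. borel) (\<lambda>k \<omega>. W (\<tau> (Suc k)) \<omega> - W (\<tau> k) \<omega>) {..<n})"

text \<open>\<open>\<mu>\<close> is the intensity measure. The Poisson weights are written out because
  \<^const>\<open>poisson_pmf\<close> excludes rate 0.\<close>

definition poisson_random_measure ::
    "'w measure \<Rightarrow> ('w \<Rightarrow> 'x measure) \<Rightarrow> 'x measure \<Rightarrow> bool" where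
  "poisson_random_measure M N \<mu> \<longleftrightarrow>
     (\<forall>\<omega>\<in>space M. sets (N \<omega>) = sets \<mu>) \<and>
     (\<forall>A\<in>sets \<mu>. (\<lambda>\<omega>. emeasure (N \<omega>) A) \<in> borel_measurable M) \<and>
     (\<forall>A\<in>sets \<mu>. emeasure \<mu> A < \<infinity> \<longrightarrow>
        (\<forall>k::nat. measure M {\<omega>\<in>space M. emeasure (N \<omega>) A = of_nat k} =
           measure \<mu> A ^ k / fact k * exp (- measure \<mu> A))) \<and>
     (\<forall>(n::nat) A. A ` {..<n} \<subseteq> sets \<mu> \<and> disjoint_family_on A {..<n} \<longrightarrow>
        prob_space.indep_vars M (\<lambda>_. borel) (\<lambda>k \<omega>. emeasure (N \<omega>) (A k)) {..<n})"

text \<open>Points of the Poisson measure are pairs \<open>(v, s)\<close> of a jump size and a time.\<close>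

definition jump_intensity :: "real measure \<Rightarrow> (real \<times> real) measure" where
  "jump_intensity \<rho> = \<rho> \<Otimes>\<^sub>M restrict_space lborel {0..}"

text \<open>\<open>X\<close> is a version of the compensated integral of \<open>f v\<close> over \<open>[0,t] \<times> \<real>\<close>:
  the \<open>L\<^sup>2\<close>-limit of the compensated sums over jumps of size greater than \<open>\<epsilon>\<close>
  as \<open>\<epsilon>\<close> tends to 0. There are in general infinitely many small jumps, so that
  the integrals against \<open>Q\<close> and against \<open>\<rho>\<close> need not exist separately.\<close>

definition is_compensated_integral ::
    "'w measure \<Rightarrow> ('w \<Rightarrow> (real \<times> real) measure) \<Rightarrow> real measure \<Rightarrow> (real \<Rightarrow> real) \<Rightarrow>
      real \<Rightarrow> ('w \<Rightarrow> real) \<Rightarrow> bool" where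
  "is_compensated_integral M Q \<rho> f t X \<longleftrightarrow>
     X \<in> borel_measurable M \<and>
     ((\<lambda>\<epsilon>. \<integral>\<^sup>+\<omega>. ennreal
          ((X \<omega> - ((\<integral>z. indicator ({v. \<bar>v\<bar> > \<epsilon>} \<times> {0..t}) z * f (fst z) \<partial>Q \<omega>)
                  - t * (\<integral>v. indicator {v. \<bar>v\<bar> > \<epsilon>} v * f v \<partial>\<rho>)))\<^sup>2) \<partial>M)
        \<longlongrightarrow> 0) (at_right 0)"

text \<open>\<open>J i p\<close> is the process \<open>J\<^sup>i\<^sup>(\<^sup>p\<^sup>)\<close>, with \<open>J i 1\<close> the process \<open>J\<^sup>i\<close>.
  Being limits in \<open>L\<^sup>2\<close>, these processes are determined up to modification, and
  linear relations between them are accordingly almost sure at each time.\<close>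

locale levy_drivers = prob_space M
  for M :: "'w measure" +
  fixes d l :: nat
    and W :: "nat \<Rightarrow> real \<Rightarrow> 'w \<Rightarrow> real"
    and \<rho> :: "nat \<Rightarrow> real measure"
    and Q :: "nat \<Rightarrow> 'w \<Rightarrow> (real \<times> real) measure"
    and J :: "nat \<Rightarrow> nat \<Rightarrow> real \<Rightarrow> 'w \<Rightarrow> real"
  assumes d_le_l: "d \<le> l"
    and wiener: "i \<in> {1..d} \<Longrightarrow> wiener_process M (W i)"
    and sets_rho: "i \<in> {d<..l} \<Longrightarrow> sets (\<rho> i) = sets borel"
    and rho_zero: "i \<in> {d<..l} \<Longrightarrow> emeasure (\<rho> i) {0} = 0"
    and rho_square: "i \<in> {d<..l} \<Longrightarrow> integrable (\<rho> i) (\<lambda>v. v\<^sup>2)"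
    and poisson: "i \<in> {d<..l} \<Longrightarrow> poisson_random_measure M (Q i) (jump_intensity (\<rho> i))"
    and compensated: "i \<in> {d<..l} \<Longrightarrow> p \<ge> 1 \<Longrightarrow> t \<ge> 0 \<Longrightarrow>
          is_compensated_integral M (Q i) (\<rho> i) (\<lambda>v. v ^ p) t (J i p t)"
    and moments: "i \<in> {d<..l} \<Longrightarrow> t \<ge> 0 \<Longrightarrow> integrable M (\<lambda>\<omega>. J i 1 t \<omega> ^ k)"
    and independent: "indep_vars (\<lambda>_. PiM {0..} (\<lambda>_. borel))
          (\<lambda>i \<omega>. \<lambda>t\<in>{0..}. if i \<le> d then W i t \<omega> else J i 1 t \<omega>) {1..l}"


section \<open>The alphabet\<close>

text \<open>The pair \<open>(i, p)\<close> encodes the letter \<open>i\<^sup>(\<^sup>p\<^sup>)\<close>; the letters \<open>0, 1, \<dots>, \<ell>\<close>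
  are the pairs \<open>(i, 1)\<close>.\<close>

type_synonym letter = "nat \<times> nat"
type_synonym word = "letter list"

definition letter0 :: letter where
  "letter0 = (0, 1)"

definition letter_process ::
    "nat \<Rightarrow> (nat \<Rightarrow> real \<Rightarrow> 'w \<Rightarrow> real) \<Rightarrow> (nat \<Rightarrow> nat \<Rightarrow> real \<Rightarrow> 'w \<Rightarrow> real) \<Rightarrow>
      letter \<Rightarrow> real \<Rightarrow> 'w \<Rightarrow> real" where
  "letter_process d W J = (\<lambda>(i, p) t \<omega>.
     if i = 0 then t else if i \<le> d then W i t \<omega> else J i p t \<omega>)"

definition in_lower_span ::
    "'w measure \<Rightarrow> (nat \<Rightarrow> nat \<Rightarrow> real \<Rightarrow> 'w \<Rightarrow> real) \<Rightarrow> nat \<Rightarrow> nat \<Rightarrow> bool" where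
  "in_lower_span M J i p \<longleftrightarrow>
     (\<exists>c0 c. \<forall>t\<ge>0. AE \<omega> in M. J i p t \<omega> = c0 * t + (\<Sum>k\<in>{1..<p}. c k * J i k t \<omega>))"

definition alphabet ::
    "'w measure \<Rightarrow> nat \<Rightarrow> nat \<Rightarrow> (nat \<Rightarrow> nat \<Rightarrow> real \<Rightarrow> 'w \<Rightarrow> real) \<Rightarrow> letter set" where
  "alphabet M d l J =
     {(i, 1) | i. i \<le> l} \<union>
     {(i, p) | i p. d < i \<and> i \<le> l \<and> p \<ge> 2 \<and> \<not> in_lower_span M J i p}"

text \<open>\<open>\<real>\<langle>A\<rangle>\<close> as the finitely supported functions on words over \<open>A\<close>.\<close>

definition word_space :: "letter set \<Rightarrow> (word \<Rightarrow>\<^sub>0 real) set" where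
  "word_space A = {x. Poly_Mapping.keys x \<subseteq> lists A}"

definition basis :: "'a \<Rightarrow> ('a \<Rightarrow>\<^sub>0 real)" where
  "basis a = Poly_Mapping.single a 1"

definition lin_extend :: "('a \<Rightarrow> 'b::real_vector) \<Rightarrow> ('a \<Rightarrow>\<^sub>0 real) \<Rightarrow> 'b" where
  "lin_extend f x = (\<Sum>a\<in>Poly_Mapping.keys x. Poly_Mapping.lookup x a *\<^sub>R f a)"

definition bilin_extend ::
    "('a \<Rightarrow> 'b \<Rightarrow> 'c::real_vector) \<Rightarrow> ('a \<Rightarrow>\<^sub>0 real) \<Rightarrow> ('b \<Rightarrow>\<^sub>0 real) \<Rightarrow> 'c" where
  "bilin_extend f x y = lin_extend (\<lambda>a. lin_extend (f a) y) x"

definition lin_endo :: "letter set \<Rightarrow> ((word \<Rightarrow>\<^sub>0 real) \<Rightarrow> (word \<Rightarrow>\<^sub>0 real)) \<Rightarrow> bool" where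
  "lin_endo A X \<longleftrightarrow>
     (\<forall>x\<in>word_space A. X x \<in> word_space A) \<and>
     (\<forall>x\<in>word_space A. \<forall>y\<in>word_space A. X (x + y) = X x + X y) \<and>
     (\<forall>c. \<forall>x\<in>word_space A. X (c *\<^sub>R x) = c *\<^sub>R X x)"


section \<open>The quasi-shuffle product\<close>

definition represents_jump ::
    "'w measure \<Rightarrow> nat \<Rightarrow> nat \<Rightarrow> (nat \<Rightarrow> real \<Rightarrow> 'w \<Rightarrow> real) \<Rightarrow>
      (nat \<Rightarrow> nat \<Rightarrow> real \<Rightarrow> 'w \<Rightarrow> real) \<Rightarrow> nat \<Rightarrow> nat \<Rightarrow> (letter \<Rightarrow>\<^sub>0 real) \<Rightarrow> bool" where
  "represents_jump M d l W J i p r \<longleftrightarrow>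
     (if (i, p) \<in> alphabet M d l J then r = basis (i, p)
      else Poly_Mapping.keys r \<subseteq> alphabet M d l J \<and>
        (\<forall>t\<ge>0. AE \<omega> in M. J i p t \<omega> = lin_extend (\<lambda>a. letter_process d W J a t \<omega>) r))"

text \<open>The bracket is given by its values on pairs of letters; its bilinear extension to the
  span of the letters is \<open>bilin_extend br\<close>.\<close>

locale levy_bracket = levy_drivers M d l W \<rho> Q J
  for M :: "'w measure" and d l W \<rho> Q J +
  fixes br :: "letter \<Rightarrow> letter \<Rightarrow> (letter \<Rightarrow>\<^sub>0 real)"
  assumes br_closed: "a \<in> alphabet M d l J \<Longrightarrow> b \<in> alphabet M d l J \<Longrightarrow>
          Poly_Mapping.keys (br a b) \<subseteq> alphabet M d l J"
    and br_commute: "a \<in> alphabet M d l J \<Longrightarrow> b \<in> alphabet M d l J \<Longrightarrow> br a b = br b a"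
    and br_assoc: "a \<in> alphabet M d l J \<Longrightarrow> b \<in> alphabet M d l J \<Longrightarrow> c \<in> alphabet M d l J \<Longrightarrow>
          bilin_extend br (br a b) (basis c) = bilin_extend br (basis a) (br b c)"
    and br_zero: "a \<in> alphabet M d l J \<Longrightarrow> br letter0 a = 0"
    and br_wiener: "i \<in> {1..d} \<Longrightarrow> j \<in> {1..d} \<Longrightarrow>
          br (i, 1) (j, 1) = (if i = j then basis letter0 else 0)"
    and br_distinct: "(i, p) \<in> alphabet M d l J \<Longrightarrow> (j, q) \<in> alphabet M d l J \<Longrightarrow> i \<noteq> j \<Longrightarrow>
          br (i, p) (j, q) = 0"
    and br_jump: "(i, p) \<in> alphabet M d l J \<Longrightarrow> (i, q) \<in> alphabet M d l J \<Longrightarrow> d < i \<Longrightarrow>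
          \<exists>r. represents_jump M d l W J i (p + q) r \<and>
            br (i, p) (i, q) = (\<integral>v. v ^ (p + q) \<partial>\<rho> i) *\<^sub>R basis letter0 + r"

definition append_letters :: "(word \<Rightarrow>\<^sub>0 real) \<Rightarrow> (letter \<Rightarrow>\<^sub>0 real) \<Rightarrow> (word \<Rightarrow>\<^sub>0 real)" where
  "append_letters = bilin_extend (\<lambda>w a. basis (w @ [a]))"

fun qshuffle_word ::
    "(letter \<Rightarrow> letter \<Rightarrow> (letter \<Rightarrow>\<^sub>0 real)) \<Rightarrow> word \<Rightarrow> word \<Rightarrow> (word \<Rightarrow>\<^sub>0 real)" where
  "qshuffle_word br u v =
     (if u = [] then basis v
      else if v = [] then basis u
      else append_letters (qshuffle_word br (butlast u) v) (basis (last u))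
         + append_letters (qshuffle_word br u (butlast v)) (basis (last v))
         + append_letters (qshuffle_word br (butlast u) (butlast v)) (br (last u) (last v)))"

declare qshuffle_word.simps [simp del]

lemma qshuffle_word_Nil [simp]:
  "qshuffle_word br u [] = basis u" "qshuffle_word br [] u = basis u"
  by (simp_all add: qshuffle_word.simps)

lemma qshuffle_word_snoc:
  "qshuffle_word br (u @ [a]) (v @ [b]) =
     append_letters (qshuffle_word br u (v @ [b])) (basis a)
     + append_letters (qshuffle_word br (u @ [a]) v) (basis b)
     + append_letters (qshuffle_word br u v) (br a b)"
  by (subst qshuffle_word.simps) simp

definition qshuffle ::
    "(letter \<Rightarrow> letter \<Rightarrow> (letter \<Rightarrow>\<^sub>0 real)) \<Rightarrow>
      (word \<Rightarrow>\<^sub>0 real) \<Rightarrow> (word \<Rightarrow>\<^sub>0 real) \<Rightarrow> (word \<Rightarrow>\<^sub>0 real)" where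
  "qshuffle br = bilin_extend (qshuffle_word br)"


section \<open>Reversal, antipode, projections, expectation\<close>

definition abs_antipode :: "(word \<Rightarrow>\<^sub>0 real) \<Rightarrow> (word \<Rightarrow>\<^sub>0 real)" where
  "abs_antipode = lin_extend (\<lambda>w. basis (rev w))"

definition signed_antipode :: "(word \<Rightarrow>\<^sub>0 real) \<Rightarrow> (word \<Rightarrow>\<^sub>0 real)" where
  "signed_antipode = lin_extend (\<lambda>w. (- 1) ^ length w *\<^sub>R basis (rev w))"

definition length_proj :: "nat \<Rightarrow> (word \<Rightarrow>\<^sub>0 real) \<Rightarrow> (word \<Rightarrow>\<^sub>0 real)" where
  "length_proj n = lin_extend (\<lambda>w. if length w = n then basis w else 0)"

definition expectation_word :: "word \<Rightarrow> real poly" where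
  "expectation_word w =
     (if set w \<subseteq> {letter0} then monom (1 / fact (length w)) (length w) else 0)"

definition expectation_map :: "(word \<Rightarrow>\<^sub>0 real) \<Rightarrow> real poly" where
  "expectation_map x =
     (\<Sum>w\<in>Poly_Mapping.keys x. smult (Poly_Mapping.lookup x w) (expectation_word w))"


section \<open>Inner products of endomorphisms\<close>

text \<open>The formal inner product: a formal series in the symbols \<open>(u,v) = (v,u)\<close>, given by the
  coefficient of each symbol. Unordered pairs of words serve as symbols since
  \<open>V\<^sub>u\<^sup>T V\<^sub>v\<close> is symmetric in \<open>u\<close> and \<open>v\<close>.\<close>

definition formal_inner ::
    "letter set \<Rightarrow> (letter \<Rightarrow> letter \<Rightarrow> (letter \<Rightarrow>\<^sub>0 real)) \<Rightarrow>
      ((word \<Rightarrow>\<^sub>0 real) \<Rightarrow> (word \<Rightarrow>\<^sub>0 real)) \<Rightarrow> ((word \<Rightarrow>\<^sub>0 real) \<Rightarrow> (word \<Rightarrow>\<^sub>0 real)) \<Rightarrow>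
      word uprod \<Rightarrow> real poly" where
  "formal_inner A br X Y s =
     (\<Sum>(u, v)\<in>{(u, v). u \<in> lists A \<and> v \<in> lists A \<and> Upair u v = s}.
        expectation_map (qshuffle br (X (basis u)) (Y (basis v))))"

text \<open>The inner product for an actual family of vectors \<open>V\<close>, evaluated at the time \<open>t\<close>.\<close>

definition endo_inner_term ::
    "(letter \<Rightarrow> letter \<Rightarrow> (letter \<Rightarrow>\<^sub>0 real)) \<Rightarrow> (word \<Rightarrow> real ^ 'm) \<Rightarrow> real \<Rightarrow>
      ((word \<Rightarrow>\<^sub>0 real) \<Rightarrow> (word \<Rightarrow>\<^sub>0 real)) \<Rightarrow> ((word \<Rightarrow>\<^sub>0 real) \<Rightarrow> (word \<Rightarrow>\<^sub>0 real)) \<Rightarrow>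
      word \<times> word \<Rightarrow> real" where
  "endo_inner_term br V t X Y = (\<lambda>(u, v).
     poly (expectation_map (qshuffle br (X (basis u)) (Y (basis v)))) t * (V u \<bullet> V v))"

definition endo_inner ::
    "letter set \<Rightarrow> (letter \<Rightarrow> letter \<Rightarrow> (letter \<Rightarrow>\<^sub>0 real)) \<Rightarrow> (word \<Rightarrow> real ^ 'm) \<Rightarrow> real \<Rightarrow>
      ((word \<Rightarrow>\<^sub>0 real) \<Rightarrow> (word \<Rightarrow>\<^sub>0 real)) \<Rightarrow> ((word \<Rightarrow>\<^sub>0 real) \<Rightarrow> (word \<Rightarrow>\<^sub>0 real)) \<Rightarrow> real" where
  "endo_inner A br V t X Y = (\<Sum>\<^sub>\<infinity>p\<in>lists A \<times> lists A. endo_inner_term br V t X Y p)"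

end

theory Submission
  imports Defs
begin

text \<open>
  The quasi-shuffle product, defined by splitting off last letters, obeys the mirrored recursion
  that splits off first letters; hence reversal of words is an endomorphism of it, for any bracket.
  Since \<open>E\<close> is invariant under reversal, \<open>E (|S| x * |S| y) = E (x * y)\<close>, and \<open>|S|\<close> is an involution,
  so all identities hold already for each pair \<open>(u, v)\<close>. For (vi), the two arguments are
  eigenvectors of \<open>|S|\<close> on words of length \<open>n\<close>, with the opposite eigenvalues
  \<open>-(-1)\<^sup>n\<close> and \<open>(-1)\<^sup>n\<close>.
\<close>

section \<open>Linear extension\<close>

lemma lookup_scaleR [simp]:
  "Poly_Mapping.lookup (c *\<^sub>R x) a = c *\<^sub>R Poly_Mapping.lookup x a"
proof -
  have "finite {i. c *\<^sub>R Poly_Mapping.lookup x i \<noteq> 0}"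
    by (rule finite_subset [OF _ finite_keys [of x]]) (auto simp: in_keys_iff)
  then show ?thesis
    by (simp add: scaleR_poly_mapping_def Abs_poly_mapping_inverse)
qed

text \<open>Cancellation can make the support of a sum smaller than the union of the supports.
  Summing over a common finite superset lets such expressions be compared.\<close>

lemma lin_extend_superset:
  assumes "finite B" "Poly_Mapping.keys x \<subseteq> B"
  shows "lin_extend f x = (\<Sum>a\<in>B. Poly_Mapping.lookup x a *\<^sub>R f a)"
  unfolding lin_extend_def
  by (rule sum.mono_neutral_left) (use assms in \<open>auto simp: in_keys_iff\<close>)

lemma linear_lin_extend: "linear (lin_extend f)"
proof (rule linearI)
  fix x y :: "'a \<Rightarrow>\<^sub>0 real" and c :: real
  let ?B = "Poly_Mapping.keys x \<union> Poly_Mapping.keys y"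
  have "lin_extend f (x + y) = (\<Sum>a\<in>?B. Poly_Mapping.lookup (x + y) a *\<^sub>R f a)"
    by (rule lin_extend_superset) (auto simp: Poly_Mapping.keys_add)
  also have "\<dots> = lin_extend f x + lin_extend f y"
    by (simp add: lin_extend_superset [of ?B] lookup_add scaleR_add_left sum.distrib)
  finally show "lin_extend f (x + y) = lin_extend f x + lin_extend f y" .
  have "lin_extend f (c *\<^sub>R x) =
      (\<Sum>a\<in>Poly_Mapping.keys x. Poly_Mapping.lookup (c *\<^sub>R x) a *\<^sub>R f a)"
    by (rule lin_extend_superset) (auto simp: in_keys_iff)
  then show "lin_extend f (c *\<^sub>R x) = c *\<^sub>R lin_extend f x"
    by (simp add: lin_extend_def scaleR_sum_right)
qed

lemma lin_extend_basis [simp]: "lin_extend f (basis a) = f a"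
  by (simp add: lin_extend_def basis_def)

lemma lin_extend_basis_id: "lin_extend basis x = x"
proof (rule poly_mapping_eqI)
  fix b
  have "Poly_Mapping.lookup (lin_extend basis x) b =
      (\<Sum>a\<in>Poly_Mapping.keys x. if a = b then Poly_Mapping.lookup x a else 0)"
    unfolding lin_extend_def Poly_Mapping.lookup_sum
    by (intro sum.cong) (auto simp: basis_def lookup_single when_def)
  also have "\<dots> = Poly_Mapping.lookup x b"
    by (simp add: in_keys_iff)
  finally show "Poly_Mapping.lookup (lin_extend basis x) b = Poly_Mapping.lookup x b" .
qed

text \<open>Every element is the finite combination \<open>lin_extend basis x\<close> of basis
  elements. This reduces the linear identities below to single words or letters.\<close>

lemma linear_eq_on_basis:
  fixes f g :: "('a \<Rightarrow>\<^sub>0 real) \<Rightarrow> 'b::real_vector"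
  assumes "linear f" "linear g" "\<And>a. f (basis a) = g (basis a)"
  shows "f x = g x"
proof -
  have "f (lin_extend basis x) = g (lin_extend basis x)"
    unfolding lin_extend_def
    using assms by (simp add: linear_sum linear_scale)
  then show ?thesis
    by (simp add: lin_extend_basis_id)
qed

lemma linear_bilin_extend_left: "linear (\<lambda>x. bilin_extend f x y)"
  unfolding bilin_extend_def by (rule linear_lin_extend)

lemma linear_bilin_extend_right: "linear (bilin_extend f x)"
  \<comment> \<open>Only the outer extension is unfolded: with \<open>x\<close> fixed, what remains
    is a finite sum of scaled linear maps.\<close>
  unfolding bilin_extend_def lin_extend_def [of _ x]
  by (intro linear_compose_sum ballI linear_compose_scale_right linear_lin_extend)

lemma bilin_extend_basis [simp]: "bilin_extend f (basis a) (basis b) = f a b"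
  by (simp add: bilin_extend_def)

lemma bilinear_eq_on_basis:
  fixes f g :: "('a \<Rightarrow>\<^sub>0 real) \<Rightarrow> ('b \<Rightarrow>\<^sub>0 real) \<Rightarrow> 'c::real_vector"
  assumes "\<And>y. linear (\<lambda>x. f x y)" "\<And>x. linear (f x)"
    and "\<And>y. linear (\<lambda>x. g x y)" "\<And>x. linear (g x)"
    and "\<And>a b. f (basis a) (basis b) = g (basis a) (basis b)"
  shows "f x y = g x y"
proof (rule linear_eq_on_basis [where f = "\<lambda>x. f x y" and g = "\<lambda>x. g x y"])
  show "f (basis a) y = g (basis a) y" for a
    by (rule linear_eq_on_basis [where f = "f (basis a)" and g = "g (basis a)"]) (use assms in auto)
qed (use assms in auto)


section \<open>Reversal and the quasi-shuffle product\<close>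

text \<open>The mirror image of \<open>append_letters\<close>, with the same argument order, so that
  reversal turns one into the other without exchanging arguments.\<close>

definition prepend_letters :: "(word \<Rightarrow>\<^sub>0 real) \<Rightarrow> (letter \<Rightarrow>\<^sub>0 real) \<Rightarrow> (word \<Rightarrow>\<^sub>0 real)" where
  "prepend_letters = bilin_extend (\<lambda>w a. basis (a # w))"

lemma linear_append_letters_left: "linear (\<lambda>x. append_letters x y)"
  and linear_append_letters_right: "linear (append_letters x)"
  and linear_prepend_letters_left: "linear (\<lambda>x. prepend_letters x y)"
  and linear_prepend_letters_right: "linear (prepend_letters x)"
  by (simp_all add: append_letters_def prepend_letters_def
      linear_bilin_extend_left linear_bilin_extend_right)

lemma append_letters_basis [simp]: "append_letters (basis w) (basis a) = basis (w @ [a])"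
  by (simp add: append_letters_def)

lemma prepend_letters_basis [simp]: "prepend_letters (basis w) (basis a) = basis (a # w)"
  by (simp add: prepend_letters_def)

lemma append_letters_basis_Nil: "append_letters (basis []) y = prepend_letters (basis []) y"
  by (rule linear_eq_on_basis [OF linear_append_letters_right linear_prepend_letters_right]) simp

text \<open>Operations at opposite ends of a word do not interfere. This exchange is what drives the
  induction for the mirrored recursion.\<close>

lemma append_prepend_letters:
  "append_letters (prepend_letters x y) z = prepend_letters (append_letters x z) y"
proof (rule bilinear_eq_on_basis [where f = "\<lambda>y z. append_letters (prepend_letters x y) z"
        and g = "\<lambda>y z. prepend_letters (append_letters x z) y"])
  fix a b
  show "append_letters (prepend_letters x (basis a)) (basis b) =
      prepend_letters (append_letters x (basis b)) (basis a)"
    by (rule linear_eq_on_basis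
        [OF linear_compose [OF linear_prepend_letters_left linear_append_letters_left, unfolded o_def]
            linear_compose [OF linear_append_letters_left linear_prepend_letters_left, unfolded o_def]])
      simp
qed (auto intro: linear_append_letters_right linear_prepend_letters_right
    linear_compose [OF linear_prepend_letters_right linear_append_letters_left, unfolded o_def]
    linear_compose [OF linear_append_letters_right linear_prepend_letters_left, unfolded o_def])

lemmas append_letters_add = linear_add [OF linear_append_letters_left]
lemmas prepend_letters_add = linear_add [OF linear_prepend_letters_left]

text \<open>Induction on the total length. Splitting off last letters on the left and then first
  letters by the induction hypothesis gives nine terms, one for each choice at the two ends.
  Splitting off last letters on the right gives the same nine terms with the end operations in the
  other order, and these commute.\<close>

lemma qshuffle_word_Cons:
  "qshuffle_word br (a # u) (b # v) =
     prepend_letters (qshuffle_word br u (b # v)) (basis a)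
     + prepend_letters (qshuffle_word br (a # u) v) (basis b)
     + prepend_letters (qshuffle_word br u v) (br a b)"
proof (induction "length u + length v" arbitrary: u v rule: less_induct)
  case less
  note linear_rules = append_letters_add prepend_letters_add append_prepend_letters
  show ?case
  proof (cases u rule: rev_cases)
    case Nil
    show ?thesis
    proof (cases v rule: rev_cases)
      case [simp]: Nil
      \<comment> \<open>For two single letters the first two summands trade places: appending
        \<open>a\<close> to \<open>b\<close> yields the same word as prepending \<open>b\<close> to
        \<open>a\<close>. The bracket is attached to the empty word, where both ends
        coincide.\<close>
      show ?thesis
        using \<open>u = []\<close> qshuffle_word_snoc [of br "[]" a "[]" b]
        by (simp add: append_letters_basis_Nil)
    next
      case [simp]: (snoc v' e)
      \<comment> \<open>Here \<open>a\<close> is both first and last letter. Splitting it off leaves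
        a product with \<open>[]\<close>, hence a single word, whose head must be pulled out by hand
        because the induction hypothesis does not cover it.\<close>
      have "append_letters (basis (b # v')) y = prepend_letters (append_letters (basis v') y) (basis b)" for y
        by (simp flip: append_prepend_letters)
      then show ?thesis
        using \<open>u = []\<close> less [of "[]" v'] qshuffle_word_snoc [of br "[]" a "b # v'" e]
          qshuffle_word_snoc [of br "[]" a v' e]
        by (simp add: linear_rules)
    qed
  next
    case u [simp]: (snoc u' c)
    show ?thesis
    proof (cases v rule: rev_cases)
      case [simp]: Nil
      \<comment> \<open>The symmetric boundary case, in which \<open>b\<close> is a whole
        factor.\<close>
      have "append_letters (basis (a # u')) y = prepend_letters (append_letters (basis u') y) (basis a)" for y
        by (simp flip: append_prepend_letters)
      then show ?thesis
        using less [of u' "[]"] qshuffle_word_snoc [of br "a # u'" c "[]" b]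
          qshuffle_word_snoc [of br u' c "[]" b]
        by (simp add: linear_rules)
    next
      case [simp]: (snoc v' e)
      show ?thesis
        using less [of u' "v' @ [e]"] less [of "u' @ [c]" v'] less [of u' v']
          qshuffle_word_snoc [of br "a # u'" c "b # v'" e] qshuffle_word_snoc [of br u' c "b # v'" e]
          qshuffle_word_snoc [of br "a # u'" c v' e] qshuffle_word_snoc [of br u' c v' e]
        by (simp add: linear_rules)
    qed
  qed
qed

lemma linear_abs_antipode: "linear abs_antipode"
  unfolding abs_antipode_def by (rule linear_lin_extend)

lemma abs_antipode_basis [simp]: "abs_antipode (basis w) = basis (rev w)"
  by (simp add: abs_antipode_def)

lemma abs_antipode_involution [simp]: "abs_antipode (abs_antipode x) = x"
  by (rule linear_eq_on_basis [OF linear_compose [OF linear_abs_antipode linear_abs_antipode,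
        unfolded o_def] linear_ident]) simp

text \<open>The second argument carries single letters, which reversal leaves alone; only the end at
  which they are attached changes.\<close>

lemma abs_antipode_append_letters:
  "abs_antipode (append_letters x y) = prepend_letters (abs_antipode x) y"
  by (rule bilinear_eq_on_basis [where f = "\<lambda>x y. abs_antipode (append_letters x y)"
        and g = "\<lambda>x y. prepend_letters (abs_antipode x) y"])
    (auto intro: linear_prepend_letters_right
      linear_compose [OF linear_append_letters_left linear_abs_antipode, unfolded o_def]
      linear_compose [OF linear_append_letters_right linear_abs_antipode, unfolded o_def]
      linear_compose [OF linear_abs_antipode linear_prepend_letters_left, unfolded o_def])

text \<open>Reversal carries the last-letter recursion for \<open>u\<close> and \<open>v\<close>
  into the first-letter recursion for \<open>rev u\<close> and \<open>rev v\<close>.\<close>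

lemma abs_antipode_qshuffle_word:
  "abs_antipode (qshuffle_word br u v) = qshuffle_word br (rev u) (rev v)"
proof (induction "length u + length v" arbitrary: u v rule: less_induct)
  case less
  show ?case
  proof (cases "u = [] \<or> v = []")
    case True
    then show ?thesis by auto
  next
    case False
    then obtain u' a v' b where "u = u' @ [a]" "v = v' @ [b]"
      by (metis rev_exhaust)
    with less show ?thesis
      by (simp add: qshuffle_word_snoc qshuffle_word_Cons linear_add [OF linear_abs_antipode]
          abs_antipode_append_letters)
  qed
qed

lemma linear_qshuffle_left: "linear (\<lambda>x. qshuffle br x y)"
  and linear_qshuffle_right: "linear (qshuffle br x)"
  by (simp_all add: qshuffle_def linear_bilin_extend_left linear_bilin_extend_right)

lemma qshuffle_basis [simp]: "qshuffle br (basis u) (basis v) = qshuffle_word br u v"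
  by (simp add: qshuffle_def)

lemma abs_antipode_qshuffle:
  "abs_antipode (qshuffle br x y) = qshuffle br (abs_antipode x) (abs_antipode y)"
  by (rule bilinear_eq_on_basis [where f = "\<lambda>x y. abs_antipode (qshuffle br x y)"
        and g = "\<lambda>x y. qshuffle br (abs_antipode x) (abs_antipode y)"])
    (auto simp: abs_antipode_qshuffle_word intro:
      linear_compose [OF linear_qshuffle_left linear_abs_antipode, unfolded o_def]
      linear_compose [OF linear_qshuffle_right linear_abs_antipode, unfolded o_def]
      linear_compose [OF linear_abs_antipode linear_qshuffle_left, unfolded o_def]
      linear_compose [OF linear_abs_antipode linear_qshuffle_right, unfolded o_def])


section \<open>Expectation and the inner product\<close>

text \<open>\<open>expectation_map\<close> is a sum of \<open>smult\<close> terms; each of its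
  coefficients is a real-valued linear extension, to which the rules for linear maps apply.\<close>

lemma coeff_expectation_map:
  "coeff (expectation_map x) k = lin_extend (\<lambda>w. coeff (expectation_word w) k) x"
  by (simp add: expectation_map_def lin_extend_def coeff_sum)

lemma expectation_map_uminus: "expectation_map (- x) = - expectation_map x"
  by (rule poly_eqI) (simp add: coeff_expectation_map linear_neg [OF linear_lin_extend])

lemma expectation_word_rev [simp]: "expectation_word (rev w) = expectation_word w"
  by (simp add: expectation_word_def)

lemma expectation_map_abs_antipode: "expectation_map (abs_antipode x) = expectation_map x"
proof (rule poly_eqI)
  fix k
  show "coeff (expectation_map (abs_antipode x)) k = coeff (expectation_map x) k"
    unfolding coeff_expectation_map
    by (rule linear_eq_on_basis [OF linear_compose [OF linear_abs_antipode linear_lin_extend,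
          unfolded o_def] linear_lin_extend]) simp
qed

lemma expectation_qshuffle_abs_antipode:
  "expectation_map (qshuffle br (abs_antipode x) (abs_antipode y)) = expectation_map (qshuffle br x y)"
  by (simp add: expectation_map_abs_antipode flip: abs_antipode_qshuffle)

text \<open>Self-adjointness follows from invariance under reversing both factors, because reversing
  the second factor twice restores it.\<close>

lemma expectation_qshuffle_abs_antipode_swap:
  "expectation_map (qshuffle br (abs_antipode x) y) = expectation_map (qshuffle br x (abs_antipode y))"
  using expectation_qshuffle_abs_antipode [of br x "abs_antipode y"] by simp

lemma qshuffle_scaleR:
  "qshuffle br (c *\<^sub>R x) (c' *\<^sub>R y) = (c * c') *\<^sub>R qshuffle br x y"
  by (simp add: linear_scale [OF linear_qshuffle_left] linear_scale [OF linear_qshuffle_right])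

text \<open>Reversing both factors preserves the expectation but multiplies the product by
  \<open>- c * c = - 1\<close>, so the expectation equals its own negative.\<close>

lemma expectation_qshuffle_eigenvectors:
  assumes "abs_antipode x = - c *\<^sub>R x" "abs_antipode y = c *\<^sub>R y" "c * c = 1"
  shows "expectation_map (qshuffle br x y) = 0"
proof -
  have "expectation_map (qshuffle br x y) = expectation_map (qshuffle br (- c *\<^sub>R x) (c *\<^sub>R y))"
    using expectation_qshuffle_abs_antipode [of br x y] assms(1,2) by simp
  also have "\<dots> = - expectation_map (qshuffle br x y)"
    unfolding qshuffle_scaleR using assms(3) by (simp add: expectation_map_uminus)
  finally show ?thesis
    by (metis equal_neg_zero)
qed

section \<open>Length projections and the signed antipode\<close>

lemma linear_length_proj: "linear (length_proj n)"
  unfolding length_proj_def by (rule linear_lin_extend)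

lemma length_proj_basis [simp]: "length_proj n (basis w) = (if length w = n then basis w else 0)"
  by (simp add: length_proj_def)

lemma signed_antipode_basis [simp]:
  "signed_antipode (basis w) = (- 1) ^ length w *\<^sub>R basis (rev w)"
  by (simp add: signed_antipode_def)

lemmas length_proj_linear_simps =
  linear_scale [OF linear_length_proj] linear_add [OF linear_length_proj]
  linear_diff [OF linear_length_proj]

lemmas abs_antipode_linear_simps =
  linear_scale [OF linear_abs_antipode] linear_add [OF linear_abs_antipode]
  linear_diff [OF linear_abs_antipode] linear_0 [OF linear_abs_antipode]

lemma expectation_length_proj_signed_antipode:
  "expectation_map (qshuffle br (length_proj n (signed_antipode (basis u)))
       (length_proj n (signed_antipode (basis v)))) =
   expectation_map (qshuffle br (length_proj n (basis u)) (length_proj n (basis v)))"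
proof -
  \<comment> \<open>Reversal preserves length, so on words of length \<open>n\<close> the antipode
    is reversal with the constant sign \<open>(- 1) ^ n\<close>; for other lengths both sides
    vanish. In the product this sign occurs twice and cancels.\<close>
  have S: "length_proj n (signed_antipode (basis w)) =
      (- 1) ^ n *\<^sub>R abs_antipode (length_proj n (basis w))" for w
    by (simp add: length_proj_linear_simps abs_antipode_linear_simps)
  have "(- 1) ^ n * (- 1) ^ n = (1::real)"
    by (simp flip: power_mult_distrib)
  then show ?thesis
    unfolding S qshuffle_scaleR by (simp add: expectation_qshuffle_abs_antipode)
qed

lemma expectation_length_proj_sym_antisym:
  "expectation_map (qshuffle br
     (length_proj n ((1/2) *\<^sub>R (basis u - signed_antipode (basis u))))
     (length_proj n ((1/2) *\<^sub>R (basis v + signed_antipode (basis v))))) = 0"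
\<comment> \<open>The witness \<open>c\<close> is the sign of the antipode on words of length
  \<open>n\<close>. A word of another length is projected to 0, which satisfies both eigenvector
  equations.\<close>
proof (rule expectation_qshuffle_eigenvectors [where c = "(- 1) ^ n"])
  show sq: "(- 1) ^ n * (- 1) ^ n = (1::real)"
    by (simp flip: power_mult_distrib)
  show "abs_antipode (length_proj n ((1/2) *\<^sub>R (basis u - signed_antipode (basis u)))) =
      - ((- 1) ^ n) *\<^sub>R length_proj n ((1/2) *\<^sub>R (basis u - signed_antipode (basis u)))"
    using sq by (simp add: length_proj_linear_simps abs_antipode_linear_simps algebra_simps)
  show "abs_antipode (length_proj n ((1/2) *\<^sub>R (basis v + signed_antipode (basis v)))) =
      (- 1) ^ n *\<^sub>R length_proj n ((1/2) *\<^sub>R (basis v + signed_antipode (basis v)))"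
    using sq by (simp add: length_proj_linear_simps abs_antipode_linear_simps algebra_simps)
qed

lemma formal_inner_cong:
  assumes "\<And>u v. expectation_map (qshuffle br (X (basis u)) (Y (basis v))) =
    expectation_map (qshuffle br (X' (basis u)) (Y' (basis v)))"
  shows "formal_inner A br X Y = formal_inner A br X' Y'"
  unfolding formal_inner_def assms ..

text \<open>The families agree term by term, so their \<open>infsum\<close> values agree whether or
  not they are summable.\<close>

lemma endo_inner_cong:
  assumes "\<And>u v. expectation_map (qshuffle br (X (basis u)) (Y (basis v))) =
    expectation_map (qshuffle br (X' (basis u)) (Y' (basis v)))"
  shows "endo_inner A br V t X Y = endo_inner A br V t X' Y'"
  unfolding endo_inner_def endo_inner_term_def assms ..

theorem lemma4:
  fixes M :: "'w measure" and d l :: nat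
    and W :: "nat \<Rightarrow> real \<Rightarrow> 'w \<Rightarrow> real"
    and \<rho> :: "nat \<Rightarrow> real measure"
    and Q :: "nat \<Rightarrow> 'w \<Rightarrow> (real \<times> real) measure"
    and J :: "nat \<Rightarrow> nat \<Rightarrow> real \<Rightarrow> 'w \<Rightarrow> real"
    and br :: "letter \<Rightarrow> letter \<Rightarrow> (letter \<Rightarrow>\<^sub>0 real)"
    and A :: "letter set"
    and n :: nat
    and V :: "word \<Rightarrow> real ^ 'm"
    and t :: real
    and u v :: word
    and X Y :: "(word \<Rightarrow>\<^sub>0 real) \<Rightarrow> (word \<Rightarrow>\<^sub>0 real)"
  assumes "levy_bracket M d l W \<rho> Q J br"
    and "A = alphabet M d l J"
    and "u \<in> lists A" "v \<in> lists A"
    and "lin_endo A X" "lin_endo A Y"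
  shows
    "\<comment> \<open>(i)\<close>
     (\<forall>x\<in>word_space A. (expectation_map \<circ> abs_antipode) x = expectation_map x) \<and>
     \<comment> \<open>(ii)\<close>
     abs_antipode (qshuffle br (basis u) (basis v)) =
       qshuffle br (abs_antipode (basis u)) (abs_antipode (basis v)) \<and>
     \<comment> \<open>(iii)\<close>
     formal_inner A br (abs_antipode \<circ> X) Y = formal_inner A br X (abs_antipode \<circ> Y) \<and>
     endo_inner A br V t (abs_antipode \<circ> X) Y = endo_inner A br V t X (abs_antipode \<circ> Y) \<and>
     \<comment> \<open>(iv)\<close>
     formal_inner A br X Y = formal_inner A br (abs_antipode \<circ> X) (abs_antipode \<circ> Y) \<and>
     endo_inner A br V t X Y = endo_inner A br V t (abs_antipode \<circ> X) (abs_antipode \<circ> Y) \<and>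
     \<comment> \<open>(v)\<close>
     formal_inner A br (length_proj n \<circ> signed_antipode) (length_proj n \<circ> signed_antipode) =
       formal_inner A br (length_proj n \<circ> id) (length_proj n \<circ> id) \<and>
     endo_inner A br V t (length_proj n \<circ> signed_antipode) (length_proj n \<circ> signed_antipode) =
       endo_inner A br V t (length_proj n \<circ> id) (length_proj n \<circ> id) \<and>
     \<comment> \<open>(vi)\<close>
     formal_inner A br (length_proj n \<circ> (\<lambda>x. (1/2) *\<^sub>R (id x - signed_antipode x)))
       (length_proj n \<circ> (\<lambda>x. (1/2) *\<^sub>R (id x + signed_antipode x))) = (\<lambda>_. 0) \<and>
     endo_inner A br V t (length_proj n \<circ> (\<lambda>x. (1/2) *\<^sub>R (id x - signed_antipode x)))
       (length_proj n \<circ> (\<lambda>x. (1/2) *\<^sub>R (id x + signed_antipode x))) = 0"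
  \<comment> \<open>The congruence rules reduce (iii) to (v) to single pairs of words; for (vi) the
    inner products are unfolded and each term vanishes. The basis rules for projection and antipode
    are withheld because they would rewrite the left-hand sides of the prepared identities.\<close>
  by (intro conjI ballI formal_inner_cong endo_inner_cong)
    (simp_all add: expectation_map_abs_antipode abs_antipode_qshuffle_word
      expectation_qshuffle_abs_antipode expectation_qshuffle_abs_antipode_swap
      expectation_length_proj_signed_antipode expectation_length_proj_sym_antisym
      formal_inner_def endo_inner_def endo_inner_term_def fun_eq_iff case_prod_beta
      del: length_proj_basis signed_antipode_basis)

end
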